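(* Let $\ell, n \geq 1$, let $\mathbf{c} \in \mathbb{R}^{\ell}$, let $\mathbf{A} \in \mathbb{Q}^{\ell \times n}$ be a matrix with rational entries and rows $\mathbf{A}_1,\dots,\mathbf{A}_\ell$, and let $\mathcal{X} \subset \mathbb{R}^n$ be a compact convex set. If $\mathrm{Sig}(\mathbf{c},\mathbf{A})(\mathbf{x}) > 0$ for all $\mathbf{x} \in \mathcal{X}$, then there exists $p \in \mathbb{Z}_+$ such that the function $$\mathbf{x} \mapsto \Big(\sum_{j=1}^{\ell} \exp(\mathbf{A}_j \mathbf{x})\Big)^p \, \mathrm{Sig}(\mathbf{c},\mathbf{A})(\mathbf{x})$$ belongs to $\mathrm{SAGE}(E_{p+1}(\mathbf{A}), \mathcal{X})$.
   Context: Notation. $\mathbb{Z}_+$ is the set of nonnegative integers. For a matrix $\mathbf{A} \in \mathbb{R}^{\ell\times n}$, $\mathbf{A}_j$ denotes its $j$-th row and $\mathbf{A}_j\mathbf{x}$ the dot product with $\mathbf{x}\in\mathbb{R}^n$. For $\mathbf{c}\in\mathbb{R}^\ell$, $\mathbf{c}_{\backslash i}$ is the vector $\mathbf{c}$ with the $i$-th coordinate removed, and inequalities between vectors are coordinatewise. Signomials. For $\mathbf{c} \in \mathbb{R}^\ell$, $\mathbf{A} \in \mathbb{R}^{\ell \times n}$, $\mathrm{Sig}(\mathbf{c},\mathbf{A}):\mathbb{R}^n\to\mathbb{R}$ is the function $\mathrm{Sig}(\mathbf{c},\mathbf{A})(\mathbf{x}) = \sum_{j=1}^\ell c_j \exp(\mathbf{A}_j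 \mathbf{x})$. Conditional AGE and SAGE signomials. For $\mathbf{A}\in\mathbb{R}^{\ell\times n}$, $\mathcal{X}\subset\mathbb{R}^n$ and $i\in\{1,\dots,\ell\}$, $$\mathrm{AGE}(\mathbf{A},\mathcal{X},i) = \{\mathrm{Sig}(\mathbf{c},\mathbf{A}) : \mathbf{c}\in\mathbb{R}^\ell,\ \mathbf{c}_{\backslash i}\geq \mathbf{0},\ \mathrm{Sig}(\mathbf{c},\mathbf{A})(\mathbf{x})\geq 0\ \ \forall \mathbf{x}\in\mathcal{X}\},$$ and $\mathrm{SAGE}(\mathbf{A},\mathcal{X}) = \sum_{i=1}^{\ell}\mathrm{AGE}(\mathbf{A},\mathcal{X},i)$ (Minkowski sum). The matrix $E_p(\mathbf{A})$. For $p\in\mathbb{Z}_+$, $E_p(\mathbf{A})$ is the matrix whose rows are the (finitely many, distinct) elements of the set $$\Big\{\sum_{i=1}^\ell w_i\mathbf{A}_i : w_i\in\mathbb{Z}_+ \text{ for all } i,\ \sum_{i=1}^\ell w_i\leq p\Big\}\subset\mathbb{R}^n$$ (the order of the rows is immaterial). *)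

theory Defs
  imports "HOL-Analysis.Analysis"
begin

(* A matrix with n columns is a finite family A of row vectors in real^'n over a row index set I.
   This lets the number of rows depend on p below, where a type of row indices could not.
   Only the values c i and A i with i in I matter. *)

definition Sig :: "'i set \<Rightarrow> ('i \<Rightarrow> real) \<Rightarrow> ('i \<Rightarrow> real ^ 'n) \<Rightarrow> real ^ 'n \<Rightarrow> real" where
  "Sig I c A = (\<lambda>x. \<Sum>j\<in>I. c j * exp (A j \<bullet> x))"

definition AGE ::
  "'i set \<Rightarrow> ('i \<Rightarrow> real ^ 'n) \<Rightarrow> (real ^ 'n) set \<Rightarrow> 'i \<Rightarrow> (real ^ 'n \<Rightarrow> real) set" where
  "AGE I A X i =
    {Sig I c A | c. (\<forall>j\<in>I - {i}. 0 \<le> c j) \<and> (\<forall>x\<in>X. 0 \<le> Sig I c A x)}"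

definition SAGE ::
  "'i set \<Rightarrow> ('i \<Rightarrow> real ^ 'n) \<Rightarrow> (real ^ 'n) set \<Rightarrow> (real ^ 'n \<Rightarrow> real) set" where
  "SAGE I A X = {(\<lambda>x. \<Sum>i\<in>I. f i x) | f. \<forall>i\<in>I. f i \<in> AGE I A X i}"

definition E_rows :: "'i set \<Rightarrow> ('i \<Rightarrow> real ^ 'n) \<Rightarrow> nat \<Rightarrow> (real ^ 'n) set" where
  "E_rows I A p =
    {(\<Sum>i\<in>I. real (w i) *\<^sub>R A i) | w :: 'i \<Rightarrow> nat. (\<Sum>i\<in>I. w i) \<le> p}"

(* Finiteness matters: a sum over an infinite index set would silently be 0. *)
lemma finite_E_rows:
  assumes "finite I"
  shows "finite (E_rows I A p)"
proof -
  have "E_rows I A p \<subseteq> (\<lambda>w. \<Sum>i\<in>I. real (w i) *\<^sub>R A i) ` (I \<rightarrow>\<^sub>E {..p})"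
  proof
    fix v assume "v \<in> E_rows I A p"
    then obtain w where v: "v = (\<Sum>i\<in>I. real (w i) *\<^sub>R A i)" and w: "(\<Sum>i\<in>I. w i) \<le> p"
      by (auto simp: E_rows_def)
    have "w i \<le> p" if "i \<in> I" for i
      using member_le_sum[of i I w] that w assms by simp
    then have "restrict w I \<in> I \<rightarrow>\<^sub>E {..p}" by auto
    moreover have "v = (\<Sum>i\<in>I. real (restrict w I i) *\<^sub>R A i)" using v by simp
    ultimately show "v \<in> (\<lambda>w. \<Sum>i\<in>I. real (w i) *\<^sub>R A i) ` (I \<rightarrow>\<^sub>E {..p})" by blast
  qed
  then show ?thesis
    by (rule finite_subset) (simp add: assms finite_PiE)
qed

lemma Sig_reindex:
  assumes "bij_betw g J I"
  shows "Sig J (c \<circ> g) (A \<circ> g) = Sig I c A"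
  using sum.reindex_bij_betw[OF assms, of "\<lambda>j. c j * exp (A j \<bullet> _)"] by (simp add: Sig_def)

lemma AGE_reindex:
  assumes g: "bij_betw g J I" and j: "j \<in> J"
  shows "AGE J (A \<circ> g) X j = AGE I A X (g j)"
proof
  show "AGE J (A \<circ> g) X j \<subseteq> AGE I A X (g j)"
  proof
    fix f assume "f \<in> AGE J (A \<circ> g) X j"
    then obtain c where f: "f = Sig J c (A \<circ> g)"
      and c: "\<forall>k\<in>J - {j}. 0 \<le> c k" "\<forall>x\<in>X. 0 \<le> f x"
      by (auto simp: AGE_def)
    define d where "d = c \<circ> the_inv_into J g"
    have d: "d (g k) = c k" if "k \<in> J" for k
      using g that by (simp add: d_def bij_betw_def the_inv_into_f_f)
    have "f = Sig J (d \<circ> g) (A \<circ> g)"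
      by (simp add: f Sig_def d)
    then have fd: "f = Sig I d A" by (simp add: Sig_reindex[OF g])
    have "\<forall>k\<in>I - {g j}. 0 \<le> d k"
      using g c(1) d by (auto simp: bij_betw_def)
    then show "f \<in> AGE I A X (g j)"
      using fd c(2) by (auto simp: AGE_def)
  qed
  show "AGE I A X (g j) \<subseteq> AGE J (A \<circ> g) X j"
  proof
    fix f assume "f \<in> AGE I A X (g j)"
    then obtain c where f: "f = Sig I c A"
      and c: "\<forall>k\<in>I - {g j}. 0 \<le> c k" "\<forall>x\<in>X. 0 \<le> f x"
      by (auto simp: AGE_def)
    have "\<forall>k\<in>J - {j}. 0 \<le> (c \<circ> g) k"
      using g j c(1) by (auto simp: bij_betw_def inj_on_def)
    moreover have "f = Sig J (c \<circ> g) (A \<circ> g)" by (simp add: f Sig_reindex[OF g])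
    ultimately show "f \<in> AGE J (A \<circ> g) X j"
      using c(2) unfolding AGE_def mem_Collect_eq by blast
  qed
qed

(* The order, or labelling, of the rows is immaterial, so a set of distinct rows R may be used
   as a matrix that is indexed by itself: SAGE R (\<lambda>r. r) X. *)
lemma SAGE_reindex:
  assumes g: "bij_betw g J I"
  shows "SAGE J (A \<circ> g) X = SAGE I A X"
proof
  show "SAGE J (A \<circ> g) X \<subseteq> SAGE I A X"
  proof
    fix h assume "h \<in> SAGE J (A \<circ> g) X"
    then obtain f where h: "h = (\<lambda>x. \<Sum>i\<in>J. f i x)"
      and f: "\<forall>j\<in>J. f j \<in> AGE I A X (g j)"
      by (auto simp: SAGE_def AGE_reindex[OF g])
    define d where "d = f \<circ> the_inv_into J g"
    have d: "d (g k) = f k" if "k \<in> J" for k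
      using g that by (simp add: d_def bij_betw_def the_inv_into_f_f)
    have "h = (\<lambda>x. \<Sum>i\<in>I. d i x)"
      using sum.reindex_bij_betw[OF g, of "\<lambda>i. d i _"] by (simp add: h d)
    moreover have "\<forall>i\<in>I. d i \<in> AGE I A X i"
      using g f d by (auto simp: bij_betw_def)
    ultimately show "h \<in> SAGE I A X" by (auto simp: SAGE_def)
  qed
  show "SAGE I A X \<subseteq> SAGE J (A \<circ> g) X"
  proof
    fix h assume "h \<in> SAGE I A X"
    then obtain f where h: "h = (\<lambda>x. \<Sum>i\<in>I. f i x)" and f: "\<forall>i\<in>I. f i \<in> AGE I A X i"
      by (auto simp: SAGE_def)
    have "h = (\<lambda>x. \<Sum>j\<in>J. (f \<circ> g) j x)"
      using sum.reindex_bij_betw[OF g, of "\<lambda>i. f i _"] by (simp add: h)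
    moreover have "\<forall>j\<in>J. (f \<circ> g) j \<in> AGE J (A \<circ> g) X j"
      using g f by (auto simp: AGE_reindex[OF g] bij_betw_def)
    ultimately show "h \<in> SAGE J (A \<circ> g) X"
      unfolding SAGE_def mem_Collect_eq by blast
  qed
qed

end

theory Submission
  imports Defs "HOL-Real_Asymp.Real_Asymp"
begin

text \<open>
  Write \<open>s(x) = \<Sum>j. exp (A\<^sub>j \<bullet> x)\<close>, \<open>f = Sig(c, A)\<close> and \<open>n = p + 1\<close>. Expanding over words
  \<open>g\<close> of length \<open>n\<close> in the row indices gives
  \<open>n s\<^sup>p f = \<Sum>g. (\<Sum>i. c(g\<^sub>i)) exp ((\<Sum>i. A(g\<^sub>i)) \<bullet> x)\<close>.
  On \<open>X\<close> compactness yields \<open>f \<ge> \<epsilon> s\<close> with \<open>\<epsilon> > 0\<close>. A Chernoff bound with parameter \<open>t\<close> shows that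
  the words with negative coefficient contribute at most
  \<open>(\<Sum>j. exp (A\<^sub>j \<bullet> x) exp (- t c\<^sub>j))\<^sup>n / t \<le> (\<rho> s)\<^sup>n / t\<close> with \<open>\<rho> < 1\<close>, whereas the other words
  contribute at least \<open>n \<epsilon> s\<^sup>n\<close>. The number of rows of \<open>E\<^sub>n(A)\<close> is polynomial in \<open>n\<close>, so for large
  \<open>n\<close> an equal share of the positive part dominates the negative term at every single row.
\<close>

section \<open>A domination criterion for SAGE membership\<close>

text \<open>Summand \<open>i\<close> carries the single negative term \<open>- b i\<close> and an
  equal share of the whole positive part. On \<open>X\<close> that share dominates all of
  \<open>Sig I b A\<close>, hence also its \<open>i\<close>-th term, so every summand is an AGE
  function.\<close>

lemma SAGE_dominated:
  fixes A :: "'i \<Rightarrow> real ^ 'n"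
  assumes I: "finite I"
    and a: "\<And>i. i \<in> I \<Longrightarrow> 0 \<le> a i" and b: "\<And>i. i \<in> I \<Longrightarrow> 0 \<le> b i"
    and dom: "\<And>x. x \<in> X \<Longrightarrow> real (card I) * Sig I b A x \<le> Sig I a A x"
  shows "Sig I (\<lambda>i. a i - b i) A \<in> SAGE I A X"
proof -
  define d where "d i = (\<lambda>k. a k / real (card I) - (if k = i then b i else 0))" for i
  have Sig_d: "Sig I (d i) A x = Sig I a A x / real (card I) - b i * exp (A i \<bullet> x)"
    if "i \<in> I" for i x
  proof -
    have "Sig I (d i) A x = (\<Sum>k\<in>I. a k * exp (A k \<bullet> x) / real (card I)
        - (if k = i then b i * exp (A i \<bullet> x) else 0))"
      unfolding Sig_def d_def by (intro sum.cong) (auto simp: left_diff_distrib)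
    then show ?thesis
      using that I by (simp add: sum_subtractf Sig_def sum_divide_distrib)
  qed
  have "Sig I (d i) A \<in> AGE I A X i" if i: "i \<in> I" for i
  proof -
    have "\<forall>k\<in>I - {i}. 0 \<le> d i k"
      by (auto simp: d_def a)
    moreover have "0 \<le> Sig I (d i) A x" if x: "x \<in> X" for x
    proof -
      have K: "real (card I) > 0"
        using i I by (auto simp: card_gt_0_iff)
      have "b i * exp (A i \<bullet> x) \<le> Sig I b A x"
        unfolding Sig_def
        by (rule member_le_sum[of i I "\<lambda>k. b k * exp (A k \<bullet> x)"]) (auto simp: i I b)
      also have "\<dots> \<le> Sig I a A x / real (card I)"
        using dom[OF x] K by (simp add: field_simps)
      finally show ?thesis using Sig_d[OF i] by simp
    qed
    ultimately show ?thesis unfolding AGE_def by blast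
  qed
  moreover have "Sig I (\<lambda>i. a i - b i) A = (\<lambda>x. \<Sum>i\<in>I. Sig I (d i) A x)"
  proof
    fix x
    have "(\<Sum>i\<in>I. Sig I (d i) A x)
        = (\<Sum>i\<in>I. Sig I a A x / real (card I) - b i * exp (A i \<bullet> x))"
      by (simp add: Sig_d)
    also have "\<dots> = Sig I a A x - Sig I b A x"
      using I by (cases "I = {}") (auto simp: sum_subtractf Sig_def)
    also have "\<dots> = Sig I (\<lambda>i. a i - b i) A x"
      by (simp add: Sig_def sum_subtractf left_diff_distrib)
    finally show "Sig I (\<lambda>i. a i - b i) A x = (\<Sum>i\<in>I. Sig I (d i) A x)" by simp
  qed
  ultimately show ?thesis
    unfolding SAGE_def mem_Collect_eq by (intro exI[of _ "\<lambda>i. Sig I (d i) A"]) blast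
qed

section \<open>Rows of \<open>E_rows\<close>: counting, and rows coming from words\<close>

text \<open>Every weight is at most the total \<open>p\<close>, so the weights on \<open>I\<close>
  are functions into \<open>{..p}\<close>. The bound is crude but polynomial in \<open>p\<close> of
  fixed degree, so a geometric factor beats it.\<close>

lemma card_E_rows_le:
  assumes "finite I"
  shows "card (E_rows I A p) \<le> (p + 1) ^ card I"
proof -
  have "E_rows I A p \<subseteq> (\<lambda>w. \<Sum>i\<in>I. real (w i) *\<^sub>R A i) ` (I \<rightarrow>\<^sub>E {..p})"
  proof
    fix v assume "v \<in> E_rows I A p"
    then obtain w where v: "v = (\<Sum>i\<in>I. real (w i) *\<^sub>R A i)" and w: "(\<Sum>i\<in>I. w i) \<le> p"
      by (auto simp: E_rows_def)
    have "w i \<le> p" if "i \<in> I" for i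
      using member_le_sum[of i I w] that w assms by simp
    then have "restrict w I \<in> I \<rightarrow>\<^sub>E {..p}" by auto
    moreover have "v = (\<Sum>i\<in>I. real (restrict w I i) *\<^sub>R A i)" using v by simp
    ultimately show "v \<in> (\<lambda>w. \<Sum>i\<in>I. real (w i) *\<^sub>R A i) ` (I \<rightarrow>\<^sub>E {..p})" by blast
  qed
  then have "card (E_rows I A p) \<le> card (I \<rightarrow>\<^sub>E {..p})"
    using assms by (intro surj_card_le) (auto simp: finite_PiE)
  then show ?thesis using assms by (simp add: card_PiE)
qed

lemma E_rows_Suc:
  assumes I: "finite I" "j \<in> I" and r: "r \<in> E_rows I A n"
  shows "A j + r \<in> E_rows I A (Suc n)"
proof -
  obtain w where w: "r = (\<Sum>i\<in>I. real (w i) *\<^sub>R A i)" "(\<Sum>i\<in>I. w i) \<le> n"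
    using r by (auto simp: E_rows_def)
  define w' where "w' i = w i + (if i = j then 1 else 0)" for i
  have "(\<Sum>i\<in>I. w' i) = (\<Sum>i\<in>I. w i) + 1"
    using I by (simp add: w'_def sum.distrib)
  moreover have "(\<Sum>i\<in>I. real (w' i) *\<^sub>R A i)
      = (\<Sum>i\<in>I. real (w i) *\<^sub>R A i + (if i = j then A j else 0))"
    by (intro sum.cong) (auto simp: w'_def algebra_simps)
  then have "(\<Sum>i\<in>I. real (w' i) *\<^sub>R A i) = A j + r"
    using I by (simp add: w sum.distrib add.commute)
  ultimately show ?thesis
    unfolding E_rows_def mem_Collect_eq using w(2) by (intro exI[of _ w']) simp
qed

lemma sum_list_rows_in_E_rows:
  assumes "finite I"
  shows "set g \<subseteq> I \<Longrightarrow> (\<Sum>i\<leftarrow>g. A i) \<in> E_rows I A (length g)"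
proof (induction g)
  case Nil
  show ?case by (auto simp: E_rows_def intro!: exI[of _ "\<lambda>_. 0"])
next
  case (Cons j g)
  then show ?case using E_rows_Suc[OF assms, of j] by simp
qed

section \<open>Expansion over words\<close>

abbreviation words :: "'i set \<Rightarrow> nat \<Rightarrow> 'i list set" where
  "words I n \<equiv> {g. set g \<subseteq> I \<and> length g = n}"

lemma sum_words_Suc:
  "(\<Sum>g\<in>words I (Suc n). f g) = (\<Sum>j\<in>I. \<Sum>g\<in>words I n. f (j # g))"
proof -
  have "(\<Sum>g\<in>words I (Suc n). f g) = (\<Sum>(g, j)\<in>words I n \<times> I. f (j # g))"
    unfolding lists_length_Suc_eq
    by (subst sum.reindex) (auto simp: inj_on_def case_prod_unfold)
  also have "\<dots> = (\<Sum>j\<in>I. \<Sum>g\<in>words I n. f (j # g))"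
    by (simp add: sum.cartesian_product[symmetric] sum.swap[of _ _ I])
  finally show ?thesis .
qed

lemma sum_words_prod:
  fixes m :: "'i \<Rightarrow> real"
  shows "(\<Sum>g\<in>words I n. \<Prod>i\<leftarrow>g. m i) = (\<Sum>j\<in>I. m j) ^ n"
proof (induction n)
  case 0
  have "words I 0 = {[]}" by auto
  then show ?case by simp
next
  case (Suc n)
  then show ?case
    by (simp add: sum_words_Suc sum_distrib_left[symmetric] sum_distrib_right[symmetric])
qed

text \<open>Each of the \<open>Suc n\<close> positions contributes the same product:
  \<open>c\<close> weights the letter there, and the other \<open>n\<close> letters are free. The
  induction splits off the first letter.\<close>

lemma sum_words_weighted:
  fixes c m :: "'i \<Rightarrow> real"
  shows "(\<Sum>g\<in>words I (Suc n). (\<Sum>i\<leftarrow>g. c i) * (\<Prod>i\<leftarrow>g. m i))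
    = real (Suc n) * (\<Sum>j\<in>I. m j) ^ n * (\<Sum>j\<in>I. c j * m j)"
proof (induction n)
  case 0
  have "words I 0 = {[]}" by auto
  then show ?case by (simp add: sum_words_Suc)
next
  case (Suc n)
  let ?W = "words I (Suc n)"
  have "(\<Sum>g\<in>words I (Suc (Suc n)). (\<Sum>i\<leftarrow>g. c i) * (\<Prod>i\<leftarrow>g. m i))
      = (\<Sum>j\<in>I. \<Sum>g\<in>?W. c j * m j * (\<Prod>i\<leftarrow>g. m i)
          + m j * ((\<Sum>i\<leftarrow>g. c i) * (\<Prod>i\<leftarrow>g. m i)))"
    by (subst sum_words_Suc) (simp add: algebra_simps)
  also have "\<dots> = (\<Sum>j\<in>I. c j * m j) * (\<Sum>g\<in>?W. \<Prod>i\<leftarrow>g. m i)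
      + (\<Sum>j\<in>I. m j) * (\<Sum>g\<in>?W. (\<Sum>i\<leftarrow>g. c i) * (\<Prod>i\<leftarrow>g. m i))"
    by (simp only: sum.distrib sum_distrib_left[symmetric] sum_distrib_right[symmetric])
  also have "\<dots> = real (Suc (Suc n)) * (\<Sum>j\<in>I. m j) ^ Suc n * (\<Sum>j\<in>I. c j * m j)"
    by (simp only: Suc sum_words_prod) (simp add: algebra_simps)
  finally show ?case .
qed

lemma exp_sum_list_inner:
  "exp ((\<Sum>i\<leftarrow>g. A i) \<bullet> x) = (\<Prod>i\<leftarrow>g. exp (A i \<bullet> x))"
  by (induction g) (auto simp: inner_add_left exp_add)

text \<open>Different words can have the same row sum, while the rows in \<open>E\<close> are
  distinct; coefficients are therefore collected over the fibres of \<open>v\<close>.\<close>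

lemma Sig_fibres:
  fixes v :: "'a \<Rightarrow> real ^ 'n"
  assumes "finite W" "finite E" "v ` W \<subseteq> E"
  shows "Sig E (\<lambda>r. \<Sum>g | g \<in> W \<and> v g = r. u g) (\<lambda>r. r) x = (\<Sum>g\<in>W. u g * exp (v g \<bullet> x))"
proof -
  have "Sig E (\<lambda>r. \<Sum>g | g \<in> W \<and> v g = r. u g) (\<lambda>r. r) x
      = (\<Sum>r\<in>E. \<Sum>g | g \<in> W \<and> v g = r. u g * exp (v g \<bullet> x))"
    unfolding Sig_def by (simp add: sum_distrib_right)
  also have "\<dots> = (\<Sum>g\<in>W. u g * exp (v g \<bullet> x))"
    using assms by (rule sum.group)
  finally show ?thesis .
qed

section \<open>The Chernoff estimate\<close>

lemma exp_minus_le_quadratic: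
  fixes u :: real
  assumes "\<bar>u\<bar> \<le> 1"
  shows "exp (- u) \<le> 1 - u + u\<^sup>2"
proof (cases "u \<ge> 0")
  case True
  \<comment> \<open>Together with \<open>1 + u \<le> exp u\<close> this gives
    \<open>1 \<le> exp u * (1 - u + u^2)\<close>.\<close>
  have "(1 + u) * (1 - u + u\<^sup>2) = 1 + u ^ 3"
    by (simp add: algebra_simps power2_eq_square power3_eq_cube)
  then have "1 \<le> (1 + u) * (1 - u + u\<^sup>2)" using True by simp
  moreover have "0 \<le> 1 - u + u\<^sup>2" using assms True by simp
  then have "(1 + u) * (1 - u + u\<^sup>2) \<le> exp u * (1 - u + u\<^sup>2)"
    by (intro mult_right_mono) auto
  ultimately show ?thesis by (simp add: exp_minus field_simps)
next
  case False
  then show ?thesis using exp_bound[of "- u"] assms by simp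
qed

text \<open>This is \<open>y \<le> exp y\<close> at \<open>y = - t * u\<close>. Trading the negative
  part for an exponential makes the sum over words factor.\<close>

lemma max_neg_le_exp:
  fixes t u :: real
  assumes "t > 0"
  shows "max (- u) 0 \<le> exp (- t * u) / t"
proof -
  have "- t * u \<le> exp (- t * u)" using exp_ge_add_one_self[of "- t * u"] by linarith
  then show ?thesis using assms by (simp add: field_simps)
qed

text \<open>
  The parameter \<open>t\<close> of the Chernoff bound is of the order \<open>\<epsilon> / max \<bar>c\<^sub>j\<bar>\<^sup>2\<close>.
\<close>
lemma exponential_tilt:
  fixes c :: "'i \<Rightarrow> real"
  assumes I: "finite I" and eps: "\<epsilon> > 0"
  obtains t \<rho> :: real where "t > 0" "0 < \<rho>" "\<rho> < 1"
    "\<And>m. (\<And>j. j \<in> I \<Longrightarrow> 0 \<le> m j) \<Longrightarrow> \<epsilon> * (\<Sum>j\<in>I. m j) \<le> (\<Sum>j\<in>I. c j * m j) \<Longrightarrow>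
      (\<Sum>j\<in>I. m j * exp (- t * c j)) \<le> \<rho> * (\<Sum>j\<in>I. m j)"
proof -
  \<comment> \<open>The summand 1 keeps \<open>C\<close> positive even if all \<open>c j\<close>
    vanish.\<close>
  define C where "C = 1 + (\<Sum>j\<in>I. \<bar>c j\<bar>)"
  have C: "C \<ge> 1" by (simp add: C_def sum_nonneg)
  have cC: "\<bar>c j\<bar> \<le> C" if "j \<in> I" for j
    using member_le_sum[of j I "\<lambda>j. \<bar>c j\<bar>"] that I by (simp add: C_def)
  \<comment> \<open>The first bound gives \<open>\<bar>t * c j\<bar> \<le> 1\<close>, as the
    quadratic estimate requires; the second makes the quadratic error at most half of the linear
    gain \<open>t * \<epsilon>\<close>.\<close>
  define t where "t = min (1 / C) (\<epsilon> / (2 * C\<^sup>2))"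
  have t: "t > 0" using C eps by (simp add: t_def)
  have "t \<le> 1 / C" "t \<le> \<epsilon> / (2 * C\<^sup>2)" by (simp_all add: t_def)
  then have tC: "t * C \<le> 1" and "t * (2 * C\<^sup>2) \<le> \<epsilon>"
    using C by (simp_all add: field_simps)
  then have tC2: "t * (t * C\<^sup>2) \<le> t * (\<epsilon> / 2)"
    using t by (intro mult_left_mono) auto
  have tilt: "(\<Sum>j\<in>I. m j * exp (- t * c j)) \<le> exp (- (t * \<epsilon> / 2)) * (\<Sum>j\<in>I. m j)"
    if m: "\<And>j. j \<in> I \<Longrightarrow> 0 \<le> m j" and em: "\<epsilon> * (\<Sum>j\<in>I. m j) \<le> (\<Sum>j\<in>I. c j * m j)"
    for m
  proof -
    let ?s = "\<Sum>j\<in>I. m j"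
    have s: "?s \<ge> 0" using m by (simp add: sum_nonneg)
    have "m j * exp (- t * c j) \<le> m j - t * (c j * m j) + t * (t * C\<^sup>2) * m j"
      if j: "j \<in> I" for j
    proof -
      have "\<bar>t * c j\<bar> \<le> t * C" using t cC[OF j] by (simp add: abs_mult)
      then have "exp (- (t * c j)) \<le> 1 - t * c j + (t * c j)\<^sup>2"
        and "(t * c j)\<^sup>2 \<le> (t * C)\<^sup>2"
        using tC by (auto intro!: exp_minus_le_quadratic simp: abs_le_square_iff[symmetric])
      then have "exp (- t * c j) \<le> 1 - t * c j + t * (t * C\<^sup>2)"
        by (simp add: power2_eq_square algebra_simps)
      from mult_left_mono[OF this m[OF j]] show ?thesis by (simp add: algebra_simps)
    qed
    then have "(\<Sum>j\<in>I. m j * exp (- t * c j))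
        \<le> (\<Sum>j\<in>I. m j - t * (c j * m j) + t * (t * C\<^sup>2) * m j)"
      by (rule sum_mono)
    also have "\<dots> = ?s - t * (\<Sum>j\<in>I. c j * m j) + t * (t * C\<^sup>2) * ?s"
      by (simp only: sum.distrib sum_subtractf sum_distrib_left)
    \<comment> \<open>The linear term is controlled only after averaging over \<open>m\<close>, by
      \<open>em\<close>; \<open>tC2\<close> lets half of its gain survive.\<close>
    also have "\<dots> \<le> ?s - t * (\<epsilon> * ?s) + t * (\<epsilon> / 2) * ?s"
      using em t s tC2 by (intro add_mono diff_mono mult_left_mono mult_right_mono) auto
    also have "\<dots> = (1 + - (t * \<epsilon> / 2)) * ?s" by (simp add: algebra_simps)
    also have "\<dots> \<le> exp (- (t * \<epsilon> / 2)) * ?s"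
      using s by (intro mult_right_mono exp_ge_add_one_self)
    finally show ?thesis .
  qed
  show thesis
    by (rule that[of t "exp (- (t * \<epsilon> / 2))"]) (use t eps tilt in auto)
qed

text \<open>Here \<open>p + 2\<close> is \<open>n + 1\<close> for the word length
  \<open>n = p + 1\<close>, matching the bound on the number of rows.\<close>

lemma polynomial_times_geometric_small:
  fixes \<rho> B :: real
  assumes "0 < \<rho>" "\<rho> < 1" "B > 0"
  obtains p :: nat where "real ((p + 2) ^ k) * \<rho> ^ (p + 1) \<le> B"
proof -
  have "((\<lambda>p. (real p + 2) ^ k * \<rho> ^ (p + 1)) \<longlongrightarrow> 0) sequentially"
    using assms(1,2) by real_asymp
  then have "((\<lambda>p. real ((p + 2) ^ k) * \<rho> ^ (p + 1)) \<longlongrightarrow> 0) sequentially"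
    by (simp add: add.commute)
  then have "eventually (\<lambda>p. real ((p + 2) ^ k) * \<rho> ^ (p + 1) < B) sequentially"
    using assms(3) by (rule order_tendstoD)
  then obtain p where "real ((p + 2) ^ k) * \<rho> ^ (p + 1) < B"
    using eventually_happens'[OF sequentially_bot] by blast
  then show thesis using that[of p] by linarith
qed

section \<open>Compactness and the choice of the exponent\<close>

text \<open>The quotient of \<open>Sig I c A\<close> by the positive sum of exponentials is
  continuous, so it attains a positive minimum on a nonempty compact \<open>X\<close>.\<close>

lemma Sig_uniformly_positive:
  fixes A :: "'i \<Rightarrow> real ^ 'n"
  assumes "finite I" "I \<noteq> {}" "compact X" and pos: "\<And>x. x \<in> X \<Longrightarrow> Sig I c A x > 0"
  obtains \<epsilon> :: real where "\<epsilon> > 0"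
    "\<And>x. x \<in> X \<Longrightarrow> \<epsilon> * (\<Sum>j\<in>I. exp (A j \<bullet> x)) \<le> Sig I c A x"
proof (cases "X = {}")
  case True
  then show thesis using that[of 1] by simp
next
  case False
  let ?s = "\<lambda>x. \<Sum>j\<in>I. exp (A j \<bullet> x)"
  have s: "?s x > 0" for x using assms by (intro sum_pos) auto
  then have "continuous_on X (\<lambda>x. Sig I c A x / ?s x)"
    unfolding Sig_def by (intro continuous_intros ballI less_imp_neq[THEN not_sym])
  then obtain y where y: "y \<in> X" "\<And>x. x \<in> X \<Longrightarrow> Sig I c A y / ?s y \<le> Sig I c A x / ?s x"
    using continuous_attains_inf[OF \<open>compact X\<close> False] by blast
  show thesis
  proof (rule that[of "Sig I c A y / ?s y"])
    show "Sig I c A y / ?s y > 0" using pos[OF y(1)] s by simp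
    show "Sig I c A y / ?s y * ?s x \<le> Sig I c A x" if "x \<in> X" for x
      using y(2)[OF that] s[of x] by (simp add: pos_le_divide_eq)
  qed
qed

theorem Sig_positive_imp_SAGE:
  fixes A :: "'i \<Rightarrow> real ^ 'n"
  assumes I: "finite I" "I \<noteq> {}" and "compact X"
    and pos: "\<And>x. x \<in> X \<Longrightarrow> Sig I c A x > 0"
  shows "\<exists>p. (\<lambda>x. (\<Sum>j\<in>I. exp (A j \<bullet> x)) ^ p * Sig I c A x)
    \<in> SAGE (E_rows I A (p + 1)) (\<lambda>r. r) X"
proof -
  let ?s = "\<lambda>x. \<Sum>j\<in>I. exp (A j \<bullet> x)"
  obtain \<epsilon> where eps: "\<epsilon> > 0" and unif: "\<And>x. x \<in> X \<Longrightarrow> \<epsilon> * ?s x \<le> Sig I c A x"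
    using Sig_uniformly_positive[OF I \<open>compact X\<close> pos] by metis
  obtain t \<rho> :: real where t: "t > 0" and rho: "0 < \<rho>" "\<rho> < 1"
    and tilt: "\<And>m. (\<And>j. j \<in> I \<Longrightarrow> 0 \<le> m j) \<Longrightarrow>
      \<epsilon> * (\<Sum>j\<in>I. m j) \<le> (\<Sum>j\<in>I. c j * m j) \<Longrightarrow>
      (\<Sum>j\<in>I. m j * exp (- t * c j)) \<le> \<rho> * (\<Sum>j\<in>I. m j)"
    using exponential_tilt[OF I(1) eps, of c] by blast
  obtain p where "real ((p + 2) ^ card I) * \<rho> ^ (p + 1) \<le> t * \<epsilon>"
    using polynomial_times_geometric_small[OF rho, of "t * \<epsilon>"] t eps by auto
  moreover define n where "n = Suc p"
  ultimately have p: "real ((n + 1) ^ card I) * \<rho> ^ n \<le> t * \<epsilon>" by simp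
  define E where "E = E_rows I A n"
  define W where "W = words I n"
  define v where "v g = (\<Sum>i\<leftarrow>g. A i)" for g
  define C where "C g = (\<Sum>i\<leftarrow>g. c i)" for g
  \<comment> \<open>Positive and negative parts are taken word by word, before collecting, so
    \<open>a r\<close> and \<open>b r\<close> may both be nonzero. Dividing by \<open>n\<close>
    cancels the factor \<open>Suc p\<close> of \<open>sum_words_weighted\<close>.\<close>
  define a where "a r = (\<Sum>g | g \<in> W \<and> v g = r. max (C g) 0 / n)" for r
  define b where "b r = (\<Sum>g | g \<in> W \<and> v g = r. max (- C g) 0 / n)" for r
  have E: "finite E" using I by (simp add: E_def finite_E_rows)
  have W: "finite W" using I by (simp add: W_def finite_lists_length_eq)
  have vWE: "v ` W \<subseteq> E"
    using sum_list_rows_in_E_rows[OF I(1)] by (auto simp: v_def W_def E_def)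
  have n: "n > 0" by (simp add: n_def)
  note Sig_a = Sig_fibres[OF W E vWE, of "\<lambda>g. max (C g) 0 / n", folded a_def]
  note Sig_b = Sig_fibres[OF W E vWE, of "\<lambda>g. max (- C g) 0 / n", folded b_def]
  have expand: "Sig E (\<lambda>r. a r - b r) (\<lambda>r. r) x = ?s x ^ p * Sig I c A x" for x
  proof -
    have "Sig E (\<lambda>r. a r - b r) (\<lambda>r. r) x = Sig E a (\<lambda>r. r) x - Sig E b (\<lambda>r. r) x"
      by (simp add: Sig_def sum_subtractf left_diff_distrib)
    also have "\<dots> = (\<Sum>g\<in>W. max (C g) 0 / n * exp (v g \<bullet> x) - max (- C g) 0 / n * exp (v g \<bullet> x))"
      by (simp only: Sig_a Sig_b sum_subtractf)
    also have "\<dots> = (\<Sum>g\<in>W. C g * exp (v g \<bullet> x) / n)"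
      by (intro sum.cong) (auto simp: max_def)
    also have "\<dots> = (\<Sum>g\<in>W. C g * exp (v g \<bullet> x)) / n"
      by (simp only: sum_divide_distrib)
    also have "\<dots> = ?s x ^ p * Sig I c A x"
      using n unfolding W_def n_def C_def v_def exp_sum_list_inner sum_words_weighted
      by (simp add: Sig_def)
    finally show ?thesis .
  qed
  have "real (card E) * Sig E b (\<lambda>r. r) x \<le> Sig E a (\<lambda>r. r) x" if x: "x \<in> X" for x
  proof -
    have s: "?s x > 0" using I by (intro sum_pos) auto
    have "Sig E b (\<lambda>r. r) x \<le> (\<Sum>g\<in>W. (\<Prod>i\<leftarrow>g. exp (A i \<bullet> x) * exp (- t * c i)) / t)"
      unfolding Sig_b
    proof (rule sum_mono)
      fix g
      have word: "exp (- t * C g) * exp (v g \<bullet> x) = (\<Prod>i\<leftarrow>g. exp (A i \<bullet> x) * exp (- t * c i))"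
        unfolding C_def v_def
        by (induction g) (auto simp: distrib_left inner_add_left exp_add exp_diff exp_minus field_simps)
      \<comment> \<open>The gain of \<open>1 / n\<close> is given away here; the geometric decay
        suffices.\<close>
      have "max (- C g) 0 / n \<le> max (- C g) 0 / 1"
        using n by (intro divide_left_mono) auto
      also have "\<dots> \<le> exp (- t * C g) / t" using max_neg_le_exp[OF t, of "C g"] by simp
      finally have "max (- C g) 0 / n * exp (v g \<bullet> x) \<le> exp (- t * C g) / t * exp (v g \<bullet> x)"
        by (rule mult_right_mono) simp
      also have "exp (- t * C g) / t * exp (v g \<bullet> x) = (\<Prod>i\<leftarrow>g. exp (A i \<bullet> x) * exp (- t * c i)) / t"
        using word by simp
      finally show "max (- C g) 0 / n * exp (v g \<bullet> x)
        \<le> (\<Prod>i\<leftarrow>g. exp (A i \<bullet> x) * exp (- t * c i)) / t" .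
    qed
    also have "\<dots> = (\<Sum>j\<in>I. exp (A j \<bullet> x) * exp (- t * c j)) ^ n / t"
      unfolding W_def by (simp only: sum_divide_distrib[symmetric] sum_words_prod)
    also have "\<dots> \<le> (\<rho> * ?s x) ^ n / t"
      using unif[OF x] t
      by (intro divide_right_mono power_mono tilt sum_nonneg) (auto simp: Sig_def)
    finally have neg: "Sig E b (\<lambda>r. r) x \<le> \<rho> ^ n * ?s x ^ n / t"
      by (simp add: power_mult_distrib)
    \<comment> \<open>The positive part equals the product plus the nonnegative \<open>b\<close>
      part, so it inherits the lower bound of the product.\<close>
    have "Sig E b (\<lambda>r. r) x \<ge> 0"
      unfolding Sig_def b_def by (intro sum_nonneg mult_nonneg_nonneg) auto
    moreover have "Sig E (\<lambda>r. a r - b r) (\<lambda>r. r) x = Sig E a (\<lambda>r. r) x - Sig E b (\<lambda>r. r) x"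
      by (simp add: Sig_def sum_subtractf left_diff_distrib)
    ultimately have "?s x ^ p * Sig I c A x \<le> Sig E a (\<lambda>r. r) x"
      using expand[of x] by linarith
    moreover have "\<epsilon> * ?s x ^ n \<le> ?s x ^ p * Sig I c A x"
      using mult_left_mono[OF unif[OF x], of "?s x ^ p"] s by (simp add: n_def algebra_simps)
    ultimately have pos': "\<epsilon> * ?s x ^ n \<le> Sig E a (\<lambda>r. r) x" by linarith
    \<comment> \<open>Both sides scale with \<open>?s x ^ n\<close>, so the choice of
      \<open>p\<close> does not depend on \<open>x\<close>; the factor \<open>t\<close> in its
      defining bound absorbs the \<open>1 / t\<close> of the Chernoff bound.\<close>
    have "real (card E) * Sig E b (\<lambda>r. r) x
        \<le> real ((n + 1) ^ card I) * (\<rho> ^ n * ?s x ^ n / t)"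
      using neg card_E_rows_le[OF I(1), of A n] \<open>Sig E b (\<lambda>r. r) x \<ge> 0\<close>
      by (intro mult_mono) (simp_all only: E_def of_nat_le_iff of_nat_0_le_iff)
    also have "\<dots> = real ((n + 1) ^ card I) * \<rho> ^ n * (?s x ^ n / t)" by simp
    also have "\<dots> \<le> t * \<epsilon> * (?s x ^ n / t)"
      using p s t by (intro mult_right_mono) auto
    also have "\<dots> = \<epsilon> * ?s x ^ n" using t by simp
    finally show ?thesis using pos' by linarith
  qed
  moreover have "0 \<le> a r" and "0 \<le> b r" for r
    by (auto simp: a_def b_def intro!: sum_nonneg)
  ultimately have "Sig E (\<lambda>r. a r - b r) (\<lambda>r. r) \<in> SAGE E (\<lambda>r. r) X"
    by (intro SAGE_dominated E)
  then show ?thesis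
    by (intro exI[of _ p]) (simp add: expand[abs_def, symmetric] E_def n_def)
qed

theorem theorem7:
  fixes A :: "real ^ 'n ^ 'l" and c :: "real ^ 'l" and X :: "(real ^ 'n) set"
  assumes rational: "\<And>i j. A $ i $ j \<in> \<rat>"
    and "compact X" and "convex X"
    and pos: "\<And>x. x \<in> X \<Longrightarrow> Sig UNIV (($) c) (($) A) x > 0"
  shows "\<exists>p :: nat.
    (\<lambda>x. (\<Sum>j\<in>UNIV. exp (A $ j \<bullet> x)) ^ p * Sig UNIV (($) c) (($) A) x)
      \<in> SAGE (E_rows UNIV (($) A) (p + 1)) (\<lambda>r. r) X"
  using \<open>compact X\<close> pos by (intro Sig_positive_imp_SAGE) auto

end
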